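(* Let $S_\omega$ be the countable sequential fan with distinguished point $P$ and points $x_{n,m}$ ($n,m\in\mathbb{N}$). For each $n\in\mathbb{N}$ let $T_n$ be the sequence $T_n(k):=x_{n,k}$ ($k\in\mathbb{N}$), and let $A_{\min}^{\mathrm{fan}}:=\{T_n:n\in\mathbb{N}\}$. Then $A_{\min}^{\mathrm{fan}}$ is a minimal test set (at $P$, in the space $X=S_\omega$). Moreover, $$|A_{\min}^{\mathrm{fan}}|=\aleph_0\qquad\text{and}\qquad |\mathcal{S}_P|=2^{\aleph_0}.$$ In particular, $|A_{\min}^{\mathrm{fan}}|<|\mathcal{S}_P|$.
   Context: $\mathbb{N}=\{1,2,3,\dots\}$. The countable sequential fan is the set $S_\omega=\{P\}\cup\{x_{n,m}:n,m\in\mathbb{N}\}$ (all listed points distinct), topologized so that each point $x_{n,m}$ is isolated and a neighborhood base at $P$ is given by the sets $U_f=\{P\}\cup\{x_{n,m}: m\ge f(n)\}$, where $f:\mathbb{N}\to\mathbb{N}$ ranges over all functions. With $X=S_\omega$: $\mathcal{S}_P$ is the set of all sequences $T=(T_n)_{n\in\mathbb{N}}$ in $X$ with $T_n\to P$. $\mathcal{D}_P$ is the set of all functions $f:X\to\mathbb{R}$ that are discontinuous at $P$. For $f\in\mathcal{D}_P$, $D(f)=\{T\in\mathcal{S}_P : f(T_n)\not\to f(P)\}$. A subset $A\subseteq\mathcal{S}_P$ is a test set if $A\cap D(f)\neq\emptyset$ for every $f\in\mathcal{D}_P$. A test set $A$ is minimal if every test set $B\subseteq A$ satisfies $B=A$.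 *)

theory Defs
  imports Complex_Main
begin

unbundle cardinal_syntax

text \<open>The index set \<open>{1, 2, 3, \<dots>}\<close> is represented by \<^typ>\<open>nat\<close>, through the order isomorphism
  \<^const>\<open>Suc\<close>: \<open>FanX n m\<close> stands for the point with the indices \<open>n + 1\<close> and \<open>m + 1\<close>, and
  sequences are indexed from 0.\<close>

datatype fan = FanP | FanX nat nat

definition fan_nbhd :: "(nat \<Rightarrow> nat) \<Rightarrow> fan set" where
  "fan_nbhd f = {FanP} \<union> {FanX n m | n m. m \<ge> f n}"

text \<open>The topology in which all \<open>FanX n m\<close> are isolated and the sets \<^term>\<open>fan_nbhd f\<close> form a
  neighbourhood base at \<^term>\<open>FanP\<close>: only a set containing
  \<^term>\<open>FanP\<close> is subject to a condition.\<close>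

instantiation fan :: topological_space
begin

definition open_fan :: "fan set \<Rightarrow> bool" where
  "open_fan U \<longleftrightarrow> (FanP \<in> U \<longrightarrow> (\<exists>f. fan_nbhd f \<subseteq> U))"

instance
proof
  show "open (UNIV :: fan set)"
    by (simp add: open_fan_def)
next
  fix S T :: "fan set"
  assume S: "open S" and T: "open T"
  show "open (S \<inter> T)"
    unfolding open_fan_def
  proof
    assume "FanP \<in> S \<inter> T"
    then obtain f g where "fan_nbhd f \<subseteq> S" and "fan_nbhd g \<subseteq> T"
      using S T by (auto simp: open_fan_def)
    then have "fan_nbhd (\<lambda>n. max (f n) (g n)) \<subseteq> S \<inter> T"
      by (auto simp: fan_nbhd_def)
    then show "\<exists>h. fan_nbhd h \<subseteq> S \<inter> T"
      by blast
  qed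
next
  fix K :: "fan set set"
  assume "\<forall>S\<in>K. open S"
  then show "open (\<Union>K)"
    unfolding open_fan_def by (meson Union_iff Union_upper subset_trans)
qed

end

lemma open_fan_isolated: "open {FanX n m}"
  by (simp add: open_fan_def)

lemma open_fan_nbhd: "open (fan_nbhd f)"
  by (auto simp: open_fan_def)

lemma eventually_nhds_P: "eventually Q (nhds FanP) \<longleftrightarrow> (\<exists>f. \<forall>y\<in>fan_nbhd f. Q y)"
proof
  assume "eventually Q (nhds FanP)"
  then show "\<exists>f. \<forall>y\<in>fan_nbhd f. Q y"
    unfolding eventually_nhds open_fan_def by blast
next
  assume "\<exists>f. \<forall>y\<in>fan_nbhd f. Q y"
  moreover have "FanP \<in> fan_nbhd f" for f
    by (simp add: fan_nbhd_def)
  ultimately show "eventually Q (nhds FanP)"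
    unfolding eventually_nhds using open_fan_nbhd by blast
qed

instance fan :: t2_space
proof
  have sep: "\<exists>U V. open U \<and> open V \<and> FanX n m \<in> U \<and> b \<in> V \<and> U \<inter> V = {}"
    if "b \<noteq> FanX n m" for n m b
  proof -
    have "fan_nbhd (\<lambda>_. Suc m) \<subseteq> - {FanX n m}"
      by (auto simp: fan_nbhd_def)
    then have "open (- {FanX n m})"
      by (auto simp: open_fan_def)
    then show ?thesis
      using that open_fan_isolated[of n m]
      by (intro exI[of _ "{FanX n m}"] exI[of _ "- {FanX n m}"]) auto
  qed
  fix a b :: fan
  assume "a \<noteq> b"
  then show "\<exists>U V. open U \<and> open V \<and> a \<in> U \<and> b \<in> V \<and> U \<inter> V = {}"
  proof (cases a)
    case (FanX n m)
    with \<open>a \<noteq> b\<close> sep show ?thesis by simp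
  next
    case FanP
    with \<open>a \<noteq> b\<close> obtain n m where "b = FanX n m"
      by (cases b) auto
    with \<open>a \<noteq> b\<close> sep[of a n m] show ?thesis by blast
  qed
qed

text \<open>\<open>conv_seqs p\<close>, \<open>discont_funs p\<close> and \<open>detecting_seqs p f\<close> are the sets usually written
  $S_p$, $D_p$ and $D(f)$. The class \<open>t2_space\<close> is required by \<^const>\<open>isCont\<close>.\<close>

definition conv_seqs :: "'a::t2_space \<Rightarrow> (nat \<Rightarrow> 'a) set" where
  "conv_seqs p = {T. T \<longlonglongrightarrow> p}"

definition discont_funs :: "'a::t2_space \<Rightarrow> ('a \<Rightarrow> real) set" where
  "discont_funs p = {f. \<not> isCont f p}"

definition detecting_seqs :: "'a::t2_space \<Rightarrow> ('a \<Rightarrow> real) \<Rightarrow> (nat \<Rightarrow> 'a) set" where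
  "detecting_seqs p f = {T \<in> conv_seqs p. \<not> (\<lambda>k. f (T k)) \<longlonglongrightarrow> f p}"

definition test_set :: "'a::t2_space \<Rightarrow> (nat \<Rightarrow> 'a) set \<Rightarrow> bool" where
  "test_set p A \<longleftrightarrow>
     A \<subseteq> conv_seqs p \<and> (\<forall>f \<in> discont_funs p. A \<inter> detecting_seqs p f \<noteq> {})"

definition minimal_test_set :: "'a::t2_space \<Rightarrow> (nat \<Rightarrow> 'a) set \<Rightarrow> bool" where
  "minimal_test_set p A \<longleftrightarrow> test_set p A \<and> (\<forall>B. test_set p B \<and> B \<subseteq> A \<longrightarrow> B = A)"

definition fan_seq :: "nat \<Rightarrow> nat \<Rightarrow> fan" where
  "fan_seq n = (\<lambda>k. FanX n k)"

definition A_min_fan :: "(nat \<Rightarrow> fan) set" where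
  "A_min_fan = {fan_seq n | n. True}"

end

theory Submission
  imports Defs "HOL-Library.Countable"
begin

text \<open>Continuity at \<^term>\<open>FanP\<close> can be checked spine by spine, because the choice of a threshold
  on each spine yields a basic neighbourhood; this gives the test set property. Minimality holds
  because the indicator function of one spine is detected by the sequence of that spine and by no
  other. Arbitrary switching between \<^term>\<open>FanP\<close> and one spine gives continuum many sequences
  converging to \<^term>\<open>FanP\<close>, and there are no more since the fan is countable.\<close>

instance fan :: countable
  by countable_datatype

lemma FanP_in_fan_nbhd [simp]: "FanP \<in> fan_nbhd f"
  by (simp add: fan_nbhd_def)

lemma tendsto_FanP_iff: "(T \<longlongrightarrow> FanP) F \<longleftrightarrow> (\<forall>f. \<forall>\<^sub>F k in F. T k \<in> fan_nbhd f)"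
proof
  assume "(T \<longlongrightarrow> FanP) F"
  then show "\<forall>f. \<forall>\<^sub>F k in F. T k \<in> fan_nbhd f"
    using FanP_in_fan_nbhd open_fan_nbhd topological_tendstoD by blast
next
  assume R: "\<forall>f. \<forall>\<^sub>F k in F. T k \<in> fan_nbhd f"
  show "(T \<longlongrightarrow> FanP) F"
  proof (rule topological_tendstoI)
    fix S :: "fan set"
    assume "open S" "FanP \<in> S"
    then obtain f where "fan_nbhd f \<subseteq> S"
      by (auto simp: open_fan_def)
    then show "\<forall>\<^sub>F k in F. T k \<in> S"
      using R eventually_mono[of "\<lambda>k. T k \<in> fan_nbhd f" F] by (meson subsetD)
  qed
qed

lemma fan_seq_tendsto: "fan_seq n \<longlonglongrightarrow> FanP"
  by (auto simp: tendsto_FanP_iff fan_seq_def fan_nbhd_def eventually_ge_at_top)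

text \<open>The nontrivial direction works because the threshold in a basic neighbourhood may vary
  freely with the spine: no uniformity across spines is needed.\<close>

lemma isCont_FanP_iff:
  fixes f :: "fan \<Rightarrow> 'a::topological_space"
  shows "isCont f FanP \<longleftrightarrow> (\<forall>n. (\<lambda>k. f (fan_seq n k)) \<longlonglongrightarrow> f FanP)"
proof
  assume "isCont f FanP"
  then show "\<forall>n. (\<lambda>k. f (fan_seq n k)) \<longlonglongrightarrow> f FanP"
    using fan_seq_tendsto isCont_tendsto_compose by blast
next
  assume R: "\<forall>n. (\<lambda>k. f (fan_seq n k)) \<longlonglongrightarrow> f FanP"
  have "(f \<longlongrightarrow> f FanP) (nhds FanP)"
  proof (rule topological_tendstoI)
    fix S :: "'a set"
    assume S: "open S" "f FanP \<in> S"
    have "\<exists>M. \<forall>k\<ge>M. f (fan_seq n k) \<in> S" for n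
      using R S topological_tendstoD unfolding eventually_sequentially[symmetric] by blast
    \<comment> \<open>Choosing one threshold per spine gives a function \<open>M\<close>, which is
      itself the index of a basic neighbourhood \<open>fan_nbhd M\<close>.\<close>
    then obtain M where "\<And>n k. k \<ge> M n \<Longrightarrow> f (fan_seq n k) \<in> S"
      by metis
    then have "\<forall>y\<in>fan_nbhd M. f y \<in> S"
      using S by (auto simp: fan_nbhd_def fan_seq_def)
    then show "\<forall>\<^sub>F y in nhds FanP. f y \<in> S"
      unfolding eventually_nhds_P by blast
  qed
  then show "isCont f FanP"
    by (simp add: isCont_def tendsto_at_iff_tendsto_nhds)
qed

lemma test_set_A_min_fan: "test_set FanP A_min_fan"
  unfolding test_set_def
proof (intro conjI ballI)
  show "A_min_fan \<subseteq> conv_seqs FanP"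
    using fan_seq_tendsto by (auto simp: A_min_fan_def conv_seqs_def)
next
  fix f :: "fan \<Rightarrow> real"
  assume "f \<in> discont_funs FanP"
  then obtain n where "\<not> (\<lambda>k. f (fan_seq n k)) \<longlonglongrightarrow> f FanP"
    by (auto simp: discont_funs_def isCont_FanP_iff)
  then have "fan_seq n \<in> A_min_fan \<inter> detecting_seqs FanP f"
    using fan_seq_tendsto by (auto simp: A_min_fan_def detecting_seqs_def conv_seqs_def)
  then show "A_min_fan \<inter> detecting_seqs FanP f \<noteq> {}"
    by blast
qed

lemma minimal_test_set_A_min_fan: "minimal_test_set FanP A_min_fan"
  unfolding minimal_test_set_def
proof (intro conjI allI impI)
  show "test_set FanP A_min_fan"
    by (rule test_set_A_min_fan)
next
  fix B
  assume B: "test_set FanP B \<and> B \<subseteq> A_min_fan"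
  have "fan_seq n \<in> B" for n
  proof -
    define f :: "fan \<Rightarrow> real" where "f = (\<lambda>y. of_bool (y \<in> range (fan_seq n)))"
    have f_P: "f FanP = 0"
      by (auto simp: f_def fan_seq_def)
    have f_seq: "(\<lambda>k. f (fan_seq n' k)) = (\<lambda>_. if n' = n then 1 else 0)" for n'
      by (auto simp: f_def fan_seq_def)
    have "\<not> isCont f FanP"
      unfolding isCont_FanP_iff f_P using f_seq[of n] by (metis LIMSEQ_const_iff zero_neq_one)
    then obtain T where T: "T \<in> B" "T \<in> detecting_seqs FanP f"
      using B unfolding test_set_def discont_funs_def by blast
    then obtain n' where n': "T = fan_seq n'"
      using B by (auto simp: A_min_fan_def)
    \<comment> \<open>For \<open>n' \<noteq> n\<close> the values of \<open>f\<close> along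
      \<open>fan_seq n'\<close> are constantly 0, which is \<open>f FanP\<close>, so
      \<open>T\<close> would not detect \<open>f\<close>.\<close>
    have "n' = n"
      using T(2) f_seq[of n'] unfolding n' by (auto simp: detecting_seqs_def f_P split: if_splits)
    with T n' show ?thesis
      by simp
  qed
  then show "B = A_min_fan"
    using B by (auto simp: A_min_fan_def)
qed

lemma card_A_min_fan: "|A_min_fan| =o natLeq"
proof -
  have "bij_betw fan_seq UNIV A_min_fan"
    by (auto simp: bij_betw_def inj_on_def A_min_fan_def fan_seq_def fun_eq_iff)
  then have "|A_min_fan| =o |UNIV :: nat set|"
    using card_of_ordIsoI ordIso_symmetric by blast
  then show ?thesis
    using card_of_nat ordIso_transitive by blast
qed

lemma card_conv_seqs_FanP: "|conv_seqs FanP| =o ctwo ^c natLeq"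
proof -
  \<comment> \<open>This is a literal equality: \<open>Func\<close> over the full domain of
    \<open>nat\<close> imposes no default value, so it contains every function from
    \<open>nat\<close> to \<open>bool\<close>.\<close>
  have cexp: "ctwo ^c natLeq = |UNIV :: (nat \<Rightarrow> bool) set|"
    by (simp add: cexp_def ctwo_def Field_natLeq Field_card_of Func_def)
  \<comment> \<open>A sequence is coded by its graph, a subset of the countable type
    \<open>nat \<times> fan\<close>, carried into \<open>nat\<close> by \<open>to_nat\<close>. This
    bounds the number of all sequences, convergent or not.\<close>
  have "inj (\<lambda>T :: nat \<Rightarrow> fan. \<lambda>j. \<exists>k. j = to_nat (k, T k))"
  proof (intro injI ext)
    fix T T' :: "nat \<Rightarrow> fan" and k
    assume "(\<lambda>j. \<exists>k. j = to_nat (k, T k)) = (\<lambda>j. \<exists>k. j = to_nat (k, T' k))"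
    \<comment> \<open>Evaluate both codes at \<open>j = to_nat (k, T k)\<close>; injectivity of
      \<open>to_nat\<close> then forces \<open>l = k\<close>.\<close>
    then have "\<exists>l. to_nat (k, T k) = to_nat (l, T' l)"
      by (metis (mono_tags))
    then show "T k = T' k"
      by auto
  qed
  then have "|conv_seqs FanP| \<le>o |UNIV :: (nat \<Rightarrow> bool) set|"
    by (intro card_of_ordLeqI) (auto intro: inj_on_subset)
  moreover have "|UNIV :: (nat \<Rightarrow> bool) set| \<le>o |conv_seqs FanP|"
  proof (rule card_of_ordLeqI)
    \<comment> \<open>The value \<open>FanP\<close> lies in every neighbourhood of the limit, so
      switching to it at any set of indices preserves convergence. It never occurs in
      \<open>fan_seq 0\<close>, so \<open>b\<close> can be recovered.\<close>
    let ?s = "\<lambda>b :: nat \<Rightarrow> bool. \<lambda>k. if b k then fan_seq 0 k else FanP"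
    show "inj ?s"
    proof (intro injI ext)
      fix b b' k
      assume "?s b = ?s b'"
      then have "?s b k = ?s b' k"
        by (rule fun_cong)
      then show "b k = b' k"
        by (auto simp: fan_seq_def split: if_splits)
    qed
    show "?s b \<in> conv_seqs FanP" for b
      using fan_seq_tendsto[of 0]
      by (auto simp: conv_seqs_def tendsto_FanP_iff intro: eventually_mono)
  qed
  ultimately show ?thesis
    by (simp add: cexp ordIso_iff_ordLeq)
qed

theorem corollary4p14:
  "minimal_test_set FanP A_min_fan \<and>
   |A_min_fan| =o natLeq \<and>
   |conv_seqs FanP| =o ctwo ^c natLeq \<and>
   |A_min_fan| <o |conv_seqs FanP|"
proof (intro conjI)
  \<comment> \<open>Cantor's theorem in cardinal form.\<close>
  have "natLeq <o ctwo ^c natLeq"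
    by (rule ordLess_ctwo_cexp[OF natLeq_Card_order])
  then show "|A_min_fan| <o |conv_seqs FanP|"
    using card_A_min_fan card_conv_seqs_FanP
    by (meson ordIso_ordLess_trans ordIso_symmetric ordLess_ordIso_trans)
qed (fact minimal_test_set_A_min_fan card_A_min_fan card_conv_seqs_FanP)+

end
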